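(* Let $ABCD$ and $PQRS$ be quadrilaterals which are in axial perspective, that is, the points $T = AB\cap PQ$, $U = BC\cap QR$, $V = CD\cap RS$, $W = DA\cap SP$ are collinear. Number the side lines of the quadrilaterals by $\ell_1=AB$, $\ell_2=BC$, $\ell_3=CD$, $\ell_4=DA$ and $m_1=PQ$, $m_2=QR$, $m_3=RS$, $m_4=SP$, and for $i\neq j$ in $\{1,2,3,4\}$ denote by $ij$ the point $\ell_i\cap m_j$ (so for example $13 = AB\cap RS$ and $42 = DA\cap QR$). Then there exist four conics $\mathcal{C}_1$, $\mathcal{C}_2$, $\mathcal{C}_3$ and $\mathcal{C}_4$ such that the points $23, 24, 32, 34, 42, 43$ lie on $\mathcal{C}_1$, the points $13, 14, 31, 34, 41, 43$ lie on $\mathcal{C}_2$, the points $12, 14, 21, 24, 41, 42$ lie on $\mathcal{C}_3$, and the points $12, 13, 21, 23, 31, 32$ lie on $\mathcal{C}_4$.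
   Context: The setting is the real projective plane (containing the Euclidean plane). The quadrilaterals are such that all the named intersection points of side lines are well defined. A conic is the zero locus of a nonzero quadratic form in homogeneous coordinates (degenerate conics are allowed). *)

theory Defs
  imports "HOL-Analysis.Analysis"
begin

text \<open>The real projective plane: a point is a line through the origin of \<open>real ^ 3\<close>;
  its nonzero vectors are the homogeneous coordinates of the point.\<close>

typedef rp2 = "{V :: (real ^ 3) set. subspace V \<and> dim V = 1}"
  morphisms vectors_of Abs_rp2
proof -
  have "span {axis 1 1 :: real ^ 3} \<in> {V. subspace V \<and> dim V = 1}"
    by (simp add: dim_insert axis_eq_0_iff)
  then show ?thesis by blast
qed

definition points_of :: "(real ^ 3) set \<Rightarrow> rp2 set" where
  "points_of V = {X. vectors_of X \<subseteq> V}"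

definition proj_line :: "rp2 set \<Rightarrow> bool" where
  "proj_line L \<longleftrightarrow> (\<exists>V. subspace V \<and> dim V = 2 \<and> L = points_of V)"

text \<open>The line through two points; meaningful only if the points are distinct.\<close>

definition join :: "rp2 \<Rightarrow> rp2 \<Rightarrow> rp2 set" where
  "join X Y = points_of (span (vectors_of X \<union> vectors_of Y))"

text \<open>The intersection point of two lines; meaningful only if the lines are distinct.\<close>

definition meet :: "rp2 set \<Rightarrow> rp2 set \<Rightarrow> rp2" where
  "meet L M = (THE X. X \<in> L \<and> X \<in> M)"

definition proj_collinear :: "rp2 set \<Rightarrow> bool" where
  "proj_collinear A \<longleftrightarrow> (\<exists>L. proj_line L \<and> A \<subseteq> L)"

text \<open>Real quadratic forms in three variables correspond bijectively to symmetric matrices, so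
  \<open>G \<noteq> 0\<close> says that the form is nonzero.  Degenerate conics are allowed, as is an empty
  or one-point real zero locus.\<close>

definition proj_conic :: "rp2 set \<Rightarrow> bool" where
  "proj_conic K \<longleftrightarrow> (\<exists>G :: real ^ 3 ^ 3. transpose G = G \<and> G \<noteq> 0 \<and>
     K = {X. \<forall>v \<in> vectors_of X. v \<bullet> (G *v v) = 0})"

lemma proj_line_join:
  assumes "X \<noteq> Y"
  shows "proj_line (join X Y)" "X \<in> join X Y" "Y \<in> join X Y"
proof -
  let ?V = "vectors_of X" and ?W = "vectors_of Y"
  have X: "subspace ?V" "dim ?V = 1" and Y: "subspace ?W" "dim ?W = 1"
    using vectors_of[of X] vectors_of[of Y] by auto
  have ne: "?V \<noteq> ?W" using assms vectors_of_inject by blast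
  have "dim (?V \<inter> ?W) \<noteq> 1"
  proof
    assume "dim (?V \<inter> ?W) = 1"
    then have "?V \<inter> ?W = ?V" "?V \<inter> ?W = ?W"
      using X Y by (metis inf_le1 inf_le2 order_refl subspace_dim_equal subspace_inter)+
    with ne show False by simp
  qed
  moreover have "dim (?V \<inter> ?W) \<le> 1"
    using X(2) dim_subset[of "?V \<inter> ?W" ?V] by simp
  moreover have "dim (span (?V \<union> ?W)) + dim (?V \<inter> ?W) = 2"
    using dim_sums_Int[OF X(1) Y(1)] X Y
    by (simp add: span_Un span_eq_iff[THEN iffD2])
  ultimately have "dim (span (?V \<union> ?W)) = 2" by linarith
  then show "proj_line (join X Y)"
    unfolding proj_line_def join_def by (intro exI[of _ "span (?V \<union> ?W)"]) simp
  show "X \<in> join X Y" "Y \<in> join X Y"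
    unfolding join_def points_of_def by (auto intro: span_base)
qed

lemma meet_unique:
  assumes "proj_line L" "proj_line M" "L \<noteq> M"
  shows "\<exists>!X. X \<in> L \<and> X \<in> M"
proof -
  obtain V W where V: "subspace V" "dim V = 2" "L = points_of V"
    and W: "subspace W" "dim W = 2" "M = points_of W"
    using assms unfolding proj_line_def by auto
  have ne: "V \<noteq> W" using assms V W by auto
  have sub: "subspace (V \<inter> W)" using V W by (simp add: subspace_inter)
  have "dim (V \<inter> W) \<noteq> 2"
  proof
    assume "dim (V \<inter> W) = 2"
    then have "V \<inter> W = V" "V \<inter> W = W"
      using V W sub by (metis inf_le1 inf_le2 order_refl subspace_dim_equal)+
    with ne show False by simp
  qed
  moreover have "dim (V \<inter> W) \<le> 2"
    using V(2) dim_subset[of "V \<inter> W" V] by simp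
  moreover have "dim {x + y |x y. x \<in> V \<and> y \<in> W} + dim (V \<inter> W) = 4"
    using dim_sums_Int[OF V(1) W(1)] V W by simp
  moreover have "dim {x + y |x y. x \<in> V \<and> y \<in> W} \<le> 3"
    using dim_subset_UNIV[of "{x + y |x y. x \<in> V \<and> y \<in> W}"] by simp
  ultimately have d: "dim (V \<inter> W) = 1" by linarith
  have v: "vectors_of (Abs_rp2 (V \<inter> W)) = V \<inter> W"
    using sub d by (simp add: Abs_rp2_inverse)
  show ?thesis
  proof (rule ex1I[of _ "Abs_rp2 (V \<inter> W)"])
    show "Abs_rp2 (V \<inter> W) \<in> L \<and> Abs_rp2 (V \<inter> W) \<in> M"
      using v V(3) W(3) by (simp add: points_of_def)
  next
    fix X assume "X \<in> L \<and> X \<in> M"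
    then have "vectors_of X \<subseteq> V \<inter> W" using V(3) W(3) by (simp add: points_of_def)
    moreover have "subspace (vectors_of X)" "dim (vectors_of X) = 1"
      using vectors_of[of X] by auto
    ultimately have "vectors_of X = V \<inter> W"
      using sub d by (metis order_refl subspace_dim_equal)
    then show "X = Abs_rp2 (V \<inter> W)" by (metis vectors_of_inverse)
  qed
qed

end

theory Submission
  imports Defs
begin

text \<open>Write a line as the kernel of a linear form, and use the same letter for both.  Let \<open>n\<close> be
  the axis.  Since \<open>\<ell>\<^sub>i \<noteq> m\<^sub>i\<close>, and \<open>n\<close> vanishes at \<open>\<ell>\<^sub>i \<inter> m\<^sub>i\<close>, the form \<open>n\<close> lies in the pencil of
  \<open>\<ell>\<^sub>i\<close> and \<open>m\<^sub>i\<close>: there is a multiple \<open>\<alpha>\<^sub>i\<close> of \<open>\<ell>\<^sub>i\<close> such that \<open>\<beta>\<^sub>i = n - \<alpha>\<^sub>i\<close> is a multiple of \<open>m\<^sub>i\<close>.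
  Take three indices, say 1, 2, 3.  The cubic \<open>\<beta>\<^sub>1\<beta>\<^sub>2\<beta>\<^sub>3 + \<alpha>\<^sub>1\<alpha>\<^sub>2\<alpha>\<^sub>3\<close> vanishes at all nine points
  \<open>\<ell>\<^sub>i \<inter> m\<^sub>j\<close>, and it is divisible by \<open>n\<close> because \<open>\<beta>\<^sub>i \<equiv> -\<alpha>\<^sub>i\<close> modulo \<open>n\<close>.  The quotient is the
  quadratic form
  \<open>q = n\<^sup>2 - n (\<alpha>\<^sub>1 + \<alpha>\<^sub>2 + \<alpha>\<^sub>3) + \<alpha>\<^sub>1\<alpha>\<^sub>2 + \<alpha>\<^sub>1\<alpha>\<^sub>3 + \<alpha>\<^sub>2\<alpha>\<^sub>3\<close>.
  Substituting \<open>\<alpha>\<^sub>i = 0\<close> and \<open>\<alpha>\<^sub>j = n\<close> gives \<open>q = 0\<close> at \<open>\<ell>\<^sub>i \<inter> m\<^sub>j\<close> for \<open>i \<noteq> j\<close>, so that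
  the conic of \<open>q\<close> contains the six points, even when some of them coincide or lie on the axis.

  The form \<open>q\<close> is not zero: it restricts to \<open>\<beta>\<^sub>2\<beta>\<^sub>3\<close> on \<open>\<ell>\<^sub>1\<close> and to \<open>\<alpha>\<^sub>2\<alpha>\<^sub>3\<close> on \<open>m\<^sub>1\<close>, and likewise
  for the other indices.  As \<open>\<alpha>\<^sub>i\<close> and \<open>\<beta>\<^sub>i\<close> never both vanish, two of the \<open>\<beta>\<^sub>i\<close> or two of the \<open>\<alpha>\<^sub>i\<close>
  are nonzero forms, and \<open>\<ell>\<^sub>i \<noteq> m\<^sub>j\<close> makes the corresponding product nonzero on the third line.
  The theorem is this result (\<open>six_points_on_conic\<close>) for each of the four triples of indices.\<close>

section \<open>Lines as kernels of linear forms\<close>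

definition line_of :: "real ^ 3 \<Rightarrow> rp2 set" where
  "line_of a = points_of {v. a \<bullet> v = 0}"

lemma mem_line_of_iff: "Z \<in> line_of a \<longleftrightarrow> (\<forall>v \<in> vectors_of Z. a \<bullet> v = 0)"
  by (auto simp: line_of_def points_of_def)

lemma proj_line_obtain_form:
  assumes "proj_line L"
  obtains a where "a \<noteq> 0" "L = line_of a"
proof -
  obtain V where V: "subspace V" "dim V = 2" "L = points_of V"
    using assms unfolding proj_line_def by auto
  obtain a where a: "a \<noteq> 0" "span V \<subseteq> {x. a \<bullet> x = 0}"
    using lowdim_subset_hyperplane[of V] V(2) by auto
  have "V = {x. a \<bullet> x = 0}"
    using a(2) span_superset[of V] V dim_hyperplane[OF a(1)]
    by (intro subspace_dim_equal) (auto simp: subspace_hyperplane)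
  with a(1) V(3) that show thesis unfolding line_of_def by blast
qed

lemma rp2_nonzero_vector:
  obtains v where "v \<in> vectors_of Z" "v \<noteq> 0"
proof -
  have "dim (vectors_of Z) = 1" using vectors_of[of Z] by auto
  then have "\<not> vectors_of Z \<subseteq> {0}" by (metis dim_eq_0 zero_neq_one)
  with that show thesis by blast
qed

lemma line_of_scaleR:
  assumes "k \<noteq> 0"
  shows "line_of (k *\<^sub>R a) = line_of a"
  using assms by (simp add: line_of_def)

text \<open>Distinct lines through \<open>Z\<close> have independent forms in the plane of forms vanishing at \<open>Z\<close>,
  and therefore span it.\<close>

lemma form_in_pencil:
  assumes "a \<noteq> 0" "b \<noteq> 0" "line_of a \<noteq> line_of b"
    and "Z \<in> line_of a" "Z \<in> line_of b" "Z \<in> line_of c"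
  obtains s t where "c = s *\<^sub>R a + t *\<^sub>R b"
proof -
  obtain v where v: "v \<in> vectors_of Z" "v \<noteq> 0" by (rule rp2_nonzero_vector)
  have orth: "v \<bullet> a = 0" "v \<bullet> b = 0" "v \<bullet> c = 0"
    using assms(4-6) v(1) by (auto simp: mem_line_of_iff inner_commute)
  have "a \<notin> span {b}"
  proof
    assume "a \<in> span {b}"
    then obtain k where "a = k *\<^sub>R b" by (auto simp: span_singleton)
    with assms(1,3) line_of_scaleR[of k b] show False by auto
  qed
  then have "dim {a, b} = 2" using \<open>b \<noteq> 0\<close> by (simp add: dim_insert)
  then have "span {a, b} = {x. v \<bullet> x = 0}"
    using orth dim_hyperplane[OF v(2)]
    by (intro subspace_dim_equal span_minimal) (auto simp: subspace_hyperplane)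
  with orth have "c \<in> span {a, b}" by simp
  with that show thesis by (auto simp: span_insert span_singleton algebra_simps)
qed

text \<open>A real line is not the union of two points, in the form used to show that a product of
  two linear forms does not vanish on a line.\<close>

lemma vector_on_line_off_two_lines:
  assumes "a \<noteq> 0" "b \<noteq> 0" "c \<noteq> 0" "line_of a \<noteq> line_of b" "line_of a \<noteq> line_of c"
  obtains v where "a \<bullet> v = 0" "b \<bullet> v \<noteq> 0" "c \<bullet> v \<noteq> 0"
proof -
  have off: "\<exists>v. a \<bullet> v = 0 \<and> d \<bullet> v \<noteq> 0" if "d \<noteq> 0" "line_of a \<noteq> line_of d" for d
  proof (rule ccontr)
    assume "\<not> ?thesis"
    then have "{v. a \<bullet> v = 0} = {v. d \<bullet> v = 0}"
      using dim_hyperplane[OF \<open>a \<noteq> 0\<close>] dim_hyperplane[OF that(1)]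
      by (intro subspace_dim_equal) (auto simp: subspace_hyperplane)
    with that(2) show False by (simp add: line_of_def)
  qed
  obtain v w where v: "a \<bullet> v = 0" "b \<bullet> v \<noteq> 0" and w: "a \<bullet> w = 0" "c \<bullet> w \<noteq> 0"
    using off assms by blast
  \<comment> \<open>One of \<open>v\<close>, \<open>w\<close> and \<open>v + w\<close> works: if neither \<open>v\<close> nor \<open>w\<close> does, then \<open>c\<close> kills \<open>v\<close> and \<open>b\<close> kills \<open>w\<close>.\<close>
  show thesis
  proof (cases "c \<bullet> v = 0 \<and> b \<bullet> w = 0")
    case True
    with v w show thesis by (intro that[of "v + w"]) (auto simp: inner_add_right)
  next
    case False
    with v w that show thesis by blast
  qed
qed

section \<open>Quadratic forms from products of linear forms\<close>

text \<open>The symmetric matrix of the quadratic form \<open>v \<mapsto> (a \<bullet> v) (b \<bullet> v)\<close>.\<close>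

definition sym_prod :: "real ^ 3 \<Rightarrow> real ^ 3 \<Rightarrow> real ^ 3 ^ 3" where
  "sym_prod a b = (\<chi> i j. (a $ i * b $ j + b $ i * a $ j) / 2)"

lemma transpose_sym_prod: "transpose (sym_prod a b) = sym_prod a b"
  by (simp add: vec_eq_iff sym_prod_def transpose_def algebra_simps)

lemma sym_prod_form: "v \<bullet> (sym_prod a b *v v) = (a \<bullet> v) * (b \<bullet> v)"
  by (simp add: sym_prod_def inner_vec_def matrix_vector_mult_def sum_3) (simp add: field_simps)

text \<open>The quotient of the cubic \<open>(n - a) (n - b) (n - c) + a b c\<close> by \<open>n\<close>.\<close>

definition quotient_form :: "real ^ 3 \<Rightarrow> real ^ 3 \<Rightarrow> real ^ 3 \<Rightarrow> real ^ 3 \<Rightarrow> real ^ 3 ^ 3" where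
  "quotient_form n a b c =
     sym_prod n n - sym_prod n (a + b + c) + sym_prod a b + sym_prod a c + sym_prod b c"

lemma transpose_quotient_form: "transpose (quotient_form n a b c) = quotient_form n a b c"
proof -
  have "transpose (M + M') = transpose M + transpose M'"
    "transpose (M - M') = transpose M - transpose M'" for M M' :: "real ^ 3 ^ 3"
    by (simp_all add: vec_eq_iff transpose_def)
  then show ?thesis by (simp add: quotient_form_def transpose_sym_prod)
qed

lemma quotient_form_value:
  "v \<bullet> (quotient_form n a b c *v v) =
     (n \<bullet> v)\<^sup>2 - (n \<bullet> v) * (a \<bullet> v + b \<bullet> v + c \<bullet> v)
     + (a \<bullet> v) * (b \<bullet> v) + (a \<bullet> v) * (c \<bullet> v) + (b \<bullet> v) * (c \<bullet> v)"
  by (simp add: quotient_form_def matrix_vector_mult_add_rdistrib matrix_vector_mult_diff_rdistrib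
      inner_add_right inner_diff_right inner_add_left sym_prod_form power2_eq_square)

lemma quotient_form_permute:
  "quotient_form n a b c = quotient_form n b c a"
  "quotient_form n a b c = quotient_form n a c b"
  by (simp_all add: quotient_form_def sym_prod_def vec_eq_iff algebra_simps)

text \<open>Both products come from the cubic: where \<open>a\<close> vanishes it reduces to \<open>n (n - b) (n - c)\<close>,
  and where \<open>n - a\<close> vanishes to \<open>a b c = n b c\<close>.  Division by \<open>n\<close> only suggests them; as
  identities they hold on the axis too.  They give both the six zeros and the nonvanishing of the form.\<close>

lemma quotient_form_value_on_line:
  "a \<bullet> v = 0 \<Longrightarrow> v \<bullet> (quotient_form n a b c *v v) = ((n - b) \<bullet> v) * ((n - c) \<bullet> v)"
  "(n - a) \<bullet> v = 0 \<Longrightarrow> v \<bullet> (quotient_form n a b c *v v) = (b \<bullet> v) * (c \<bullet> v)"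
  unfolding quotient_form_value
  by (simp_all add: inner_diff_left power2_eq_square algebra_simps)

lemma quotient_form_nonzeroI:
  assumes "x \<noteq> 0" "y \<noteq> 0" "z \<noteq> 0" "line_of x \<noteq> line_of y" "line_of x \<noteq> line_of z"
    and "\<And>v. x \<bullet> v = 0 \<Longrightarrow> v \<bullet> (G *v v) = k * (y \<bullet> v) * (z \<bullet> v)" and "k \<noteq> (0::real)"
  shows "G \<noteq> 0"
proof -
  obtain v where "x \<bullet> v = 0" "y \<bullet> v \<noteq> 0" "z \<bullet> v \<noteq> 0"
    using assms(1-5) by (rule vector_on_line_off_two_lines)
  with assms(6)[of v] assms(7) show "G \<noteq> 0" by auto
qed

section \<open>Six points on a conic\<close>

text \<open>Two triples of lines in axial perspective.  The triples are families indexed by an arbitrary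
  set of three indices, so that any three of the four pairs of side lines can be selected.
  The conic is that of the quotient form of the rescaled forms \<open>\<alpha>\<close>, whose complements
  \<open>n - \<alpha>\<close> are multiples of the forms \<open>b\<close> of the second triple.\<close>

lemma six_points_on_conic:
  fixes L M :: "'i \<Rightarrow> rp2 set" and i j k :: 'i
  defines "I \<equiv> {i, j, k}"
  assumes "proj_line N"
    and "\<And>x. x \<in> I \<Longrightarrow> proj_line (L x)" "\<And>x. x \<in> I \<Longrightarrow> proj_line (M x)"
    and neq: "\<And>x y. x \<in> I \<Longrightarrow> y \<in> I \<Longrightarrow> L x \<noteq> M y"
    and persp: "\<And>x. x \<in> I \<Longrightarrow> \<exists>Z \<in> N. Z \<in> L x \<and> Z \<in> M x"
    and dist: "i \<noteq> j" "j \<noteq> k" "i \<noteq> k"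
  shows "\<exists>C. proj_conic C \<and>
    (\<forall>x \<in> I. \<forall>y \<in> I. x \<noteq> y \<longrightarrow> L x \<inter> M y \<subseteq> C)"
proof -
  obtain n where n: "n \<noteq> 0" "N = line_of n"
    using \<open>proj_line N\<close> by (rule proj_line_obtain_form)
  have "\<exists>a. \<forall>x \<in> I. a x \<noteq> 0 \<and> L x = line_of (a x)"
    using assms(3) by (intro bchoice) (metis proj_line_obtain_form)
  then obtain a where a: "\<And>x. x \<in> I \<Longrightarrow> a x \<noteq> 0" "\<And>x. x \<in> I \<Longrightarrow> L x = line_of (a x)" by blast
  have "\<exists>b. \<forall>x \<in> I. b x \<noteq> 0 \<and> M x = line_of (b x)"
    using assms(4) by (intro bchoice) (metis proj_line_obtain_form)
  then obtain b where b: "\<And>x. x \<in> I \<Longrightarrow> b x \<noteq> 0" "\<And>x. x \<in> I \<Longrightarrow> M x = line_of (b x)" by blast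
  have ab: "line_of (a x) \<noteq> line_of (b y)" if "x \<in> I" "y \<in> I" for x y
    using neq[OF that] a(2) b(2) that by simp
  have "\<exists>s. \<forall>x \<in> I. \<exists>t. n = s x *\<^sub>R a x + t *\<^sub>R b x"
  proof (intro bchoice ballI)
    fix x assume x: "x \<in> I"
    then obtain Z where "Z \<in> line_of n" "Z \<in> line_of (a x)" "Z \<in> line_of (b x)"
      using persp n(2) a(2) b(2) by metis
    then show "\<exists>s t. n = s *\<^sub>R a x + t *\<^sub>R b x"
      using form_in_pencil[OF a(1)[OF x] b(1)[OF x] ab[OF x x]] by metis
  qed
  then obtain s where "\<forall>x \<in> I. \<exists>t. n = s x *\<^sub>R a x + t *\<^sub>R b x" by blast
  from bchoice[OF this] obtain t where st: "\<And>x. x \<in> I \<Longrightarrow> n = s x *\<^sub>R a x + t x *\<^sub>R b x" by blast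
  have st0: "s x \<noteq> 0 \<or> t x \<noteq> 0" if "x \<in> I" for x
    using st[OF that] n(1) by auto
  define \<alpha> where "\<alpha> x = s x *\<^sub>R a x" for x
  have \<beta>: "n - \<alpha> x = t x *\<^sub>R b x" if "x \<in> I" for x
    using st[OF that] by (simp add: \<alpha>_def)
  define G where "G = quotient_form n (\<alpha> i) (\<alpha> j) (\<alpha> k)"
  have G: "G = quotient_form n (\<alpha> x) (\<alpha> y) (\<alpha> z)"
    if "x \<in> I" "y \<in> I" "z \<in> I" "x \<noteq> y" "y \<noteq> z" "x \<noteq> z" for x y z
    using that dist unfolding I_def G_def by (metis empty_iff insert_iff quotient_form_permute)

  have on_L: "G \<noteq> 0"
    if "x \<in> I" "y \<in> I" "z \<in> I" "x \<noteq> y" "y \<noteq> z" "x \<noteq> z" "t y \<noteq> 0" "t z \<noteq> 0" for x y z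
  proof (rule quotient_form_nonzeroI)
    show "v \<bullet> (G *v v) = (t y * t z) * (b y \<bullet> v) * (b z \<bullet> v)" if "a x \<bullet> v = 0" for v
      using that quotient_form_value_on_line(1)[of "\<alpha> x" v n "\<alpha> y" "\<alpha> z"]
        G[OF \<open>x \<in> I\<close> \<open>y \<in> I\<close> \<open>z \<in> I\<close> \<open>x \<noteq> y\<close> \<open>y \<noteq> z\<close> \<open>x \<noteq> z\<close>] \<beta>[OF \<open>y \<in> I\<close>] \<beta>[OF \<open>z \<in> I\<close>]
      by (simp add: \<alpha>_def)
  qed (use that a(1) b(1) ab in auto)
  have on_M: "G \<noteq> 0"
    if "x \<in> I" "y \<in> I" "z \<in> I" "x \<noteq> y" "y \<noteq> z" "x \<noteq> z" "s y \<noteq> 0" "s z \<noteq> 0" for x y z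
  proof (rule quotient_form_nonzeroI)
    show "v \<bullet> (G *v v) = (s y * s z) * (a y \<bullet> v) * (a z \<bullet> v)" if "b x \<bullet> v = 0" for v
      using that quotient_form_value_on_line(2)[of n "\<alpha> x" v "\<alpha> y" "\<alpha> z"]
        G[OF \<open>x \<in> I\<close> \<open>y \<in> I\<close> \<open>z \<in> I\<close> \<open>x \<noteq> y\<close> \<open>y \<noteq> z\<close> \<open>x \<noteq> z\<close>] \<beta>[OF \<open>x \<in> I\<close>]
      by (simp add: \<alpha>_def)
  qed (use that a(1) b(1) ab[THEN not_sym] in auto)
  \<comment> \<open>Pigeonhole: each index has a nonzero \<open>s\<close> or a nonzero \<open>t\<close>, so one kind occurs twice.\<close>
  have mem: "i \<in> I" "j \<in> I" "k \<in> I" by (auto simp: I_def)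
  have "G \<noteq> 0"
    using on_L[of i j k] on_L[of j i k] on_L[of k i j] on_M[of i j k] on_M[of j i k]
      on_M[of k i j] st0[OF mem(1)] st0[OF mem(2)] st0[OF mem(3)] mem dist by metis

  define C where "C = {Z. \<forall>v \<in> vectors_of Z. v \<bullet> (G *v v) = 0}"
  have "proj_conic C"
    unfolding proj_conic_def C_def using \<open>G \<noteq> 0\<close> transpose_quotient_form G_def by blast
  moreover have "L x \<inter> M y \<subseteq> C" if xy: "x \<in> I" "y \<in> I" "x \<noteq> y" for x y
  proof
    fix Z assume "Z \<in> L x \<inter> M y"
    then have Z: "a x \<bullet> v = 0" "b y \<bullet> v = 0" if "v \<in> vectors_of Z" for v
      using that a(2) b(2) xy by (auto simp: mem_line_of_iff)
    obtain z where z: "z \<in> I" "y \<noteq> z" "x \<noteq> z" using xy dist unfolding I_def by auto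
    have "v \<bullet> (G *v v) = 0" if "v \<in> vectors_of Z" for v
      using Z[OF that] quotient_form_value_on_line(1)[of "\<alpha> x" v n "\<alpha> y" "\<alpha> z"]
        G[OF xy(1,2) z(1) xy(3) z(2,3)] \<beta>[OF xy(2)]
      by (simp add: \<alpha>_def)
    then show "Z \<in> C" by (simp add: C_def)
  qed
  ultimately show ?thesis by blast
qed

lemma meet_mem:
  assumes "proj_line L" "proj_line M" "L \<noteq> M"
  shows "meet L M \<in> L" "meet L M \<in> M"
  using theI'[OF meet_unique[OF assms]] by (simp_all add: meet_def)

section \<open>Quadrilaterals in axial perspective\<close>

theorem theorem1p3:
  fixes A B C D P Q R S T U V W :: rp2
    and l m :: "nat \<Rightarrow> rp2 set"
    and X :: "nat \<Rightarrow> nat \<Rightarrow> rp2"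
  assumes "A \<noteq> B" "B \<noteq> C" "C \<noteq> D" "D \<noteq> A"
    and "P \<noteq> Q" "Q \<noteq> R" "R \<noteq> S" "S \<noteq> P"
    and "l 1 = join A B" "l 2 = join B C" "l 3 = join C D" "l 4 = join D A"
    and "m 1 = join P Q" "m 2 = join Q R" "m 3 = join R S" "m 4 = join S P"
    and "\<And>i j. i \<in> {1..4} \<Longrightarrow> j \<in> {1..4} \<Longrightarrow> l i \<noteq> m j"
    and "T = meet (join A B) (join P Q)" "U = meet (join B C) (join Q R)"
    and "V = meet (join C D) (join R S)" "W = meet (join D A) (join S P)"
    and "proj_collinear {T, U, V, W}"
    and "\<And>i j. i \<in> {1..4} \<Longrightarrow> j \<in> {1..4} \<Longrightarrow> i \<noteq> j \<Longrightarrow> X i j = meet (l i) (m j)"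
  shows "\<exists>C1 C2 C3 C4. proj_conic C1 \<and> proj_conic C2 \<and> proj_conic C3 \<and> proj_conic C4 \<and>
    {X 2 3, X 2 4, X 3 2, X 3 4, X 4 2, X 4 3} \<subseteq> C1 \<and>
    {X 1 3, X 1 4, X 3 1, X 3 4, X 4 1, X 4 3} \<subseteq> C2 \<and>
    {X 1 2, X 1 4, X 2 1, X 2 4, X 4 1, X 4 2} \<subseteq> C3 \<and>
    {X 1 2, X 1 3, X 2 1, X 2 3, X 3 1, X 3 2} \<subseteq> C4"
proof -
  have four: "{1..4} = {1, 2, 3, 4 :: nat}" by auto
  have lines: "proj_line (l x)" "proj_line (m x)" if "x \<in> {1..4}" for x
    using that assms(1-16) proj_line_join(1) unfolding four by auto
  have neq: "l x \<noteq> m y" if "x \<in> {1..4}" "y \<in> {1..4}" for x y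
    using assms(17) that by blast
  obtain N where N: "proj_line N" "{T, U, V, W} \<subseteq> N"
    using \<open>proj_collinear {T, U, V, W}\<close> unfolding proj_collinear_def by blast
  have "T = meet (l 1) (m 1)" "U = meet (l 2) (m 2)" "V = meet (l 3) (m 3)" "W = meet (l 4) (m 4)"
    using assms(9-16,18-21) by simp_all
  then have "meet (l x) (m x) \<in> N" if "x \<in> {1..4}" for x
    using that N(2) unfolding four by auto
  then have persp: "\<exists>Z \<in> N. Z \<in> l x \<and> Z \<in> m x" if "x \<in> {1..4}" for x
    using that meet_mem[OF lines neq] by blast
  have conic: "\<exists>C. proj_conic C \<and> {X i j, X i k, X j i, X j k, X k i, X k j} \<subseteq> C"
    if sub: "{i, j, k} \<subseteq> {1..4}" and dist: "i \<noteq> j" "j \<noteq> k" "i \<noteq> k" for i j k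
  proof -
    have I: "x \<in> {1..4}" if "x \<in> {i, j, k}" for x using that sub by blast
    obtain C where C: "proj_conic C"
      "\<And>x y. x \<in> {i, j, k} \<Longrightarrow> y \<in> {i, j, k} \<Longrightarrow> x \<noteq> y \<Longrightarrow> l x \<inter> m y \<subseteq> C"
    proof -
      have "\<exists>C. proj_conic C \<and>
          (\<forall>x \<in> {i, j, k}. \<forall>y \<in> {i, j, k}. x \<noteq> y \<longrightarrow> l x \<inter> m y \<subseteq> C)"
        by (rule six_points_on_conic[OF N(1)]) (fact lines[OF I] neq[OF I I] persp[OF I] dist)+
      with that show thesis by meson
    qed
    have "X x y \<in> C" if "x \<in> {i, j, k}" "y \<in> {i, j, k}" "x \<noteq> y" for x y
    proof -
      have "X x y = meet (l x) (m y)"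
        using assms(23) I[OF that(1)] I[OF that(2)] that(3) by blast
      moreover have "meet (l x) (m y) \<in> l x \<inter> m y"
        using that(1,2) by (intro IntI meet_mem lines neq I)
      ultimately show ?thesis using C(2)[OF that] by auto
    qed
    with C(1) dist show ?thesis by (intro exI[of _ C]) auto
  qed
  show ?thesis
    using conic[of 2 3 4] conic[of 1 3 4] conic[of 1 2 4] conic[of 1 2 3] by simp blast
qed

end
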